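(* For every $n\in\mathbb{N}$, the graph $2LK_{1,1}\cup LK_{1,n}$ is super edge-magic.
   Context: Graphs are finite and undirected, may contain loops, but multiple edges are not allowed. $\mathbb{N}$ denotes the positive integers, and for integers $m\le n$, $[m,n]=\{m,m+1,\dots,n\}$. $LK_{1,n}$ is the graph obtained from the star $K_{1,n}$ (one central vertex joined to $n$ other vertices) by attaching a loop at its central vertex (for $n=1$: an edge with a loop at one of its two endpoints). For a positive integer $t$ and a graph $G$, $tG$ denotes the disjoint union of $t$ copies of $G$; $\cup$ denotes disjoint union of graphs. Let $G$ be a graph with $p$ vertices and $q$ edges (loops count as edges). $G$ is edge-magic if there is a bijection $f:V(G)\cup E(G)\to[1,p+q]$ and a constant $k$ such that $f(x)+f(xy)+f(y)=k$ for every edge $xy\in E(G)$ (for a loop, $x=y$). $G$ is super edge-magic if there is such an $f$ with, in addition, $f(V(G))=[1,p]$. It is known that, equivalently, $G$ is super edge-magic if and only if there is a bijection $g:V(G)\to[1,p]$ such that $\{g(u)+g(v):uv\in E(G)\}$ is a set of $q$ consecutive integers (a loop at $u$ contributes $2g(u)$). *)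

theory Defs
  imports Main
begin

text \<open>
  Finite undirected graphs, loops allowed and no multiple edges: an edge is the set of its end
  vertices, so that an edge joining \<open>x\<close> and \<open>y\<close> is \<open>{x, y}\<close> and a loop at \<open>x\<close> is
  \<open>{x, x} = {x}\<close>.
\<close>

record 'a graph =
  verts :: "'a set"
  edges :: "'a set set"

definition wf_graph :: "'a graph \<Rightarrow> bool" where
  "wf_graph G \<longleftrightarrow> finite (verts G) \<and>
     (\<forall>e \<in> edges G. \<exists>x \<in> verts G. \<exists>y \<in> verts G. e = {x, y})"

definition star :: "nat \<Rightarrow> nat graph" where
  "star n = \<lparr>verts = {0..n}, edges = {{0, i} | i. i \<in> {1..n}}\<rparr>"

definition attach_loop :: "'a \<Rightarrow> 'a graph \<Rightarrow> 'a graph" where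
  "attach_loop x G = \<lparr>verts = verts G, edges = insert {x} (edges G)\<rparr>"

text \<open>The star has central vertex \<open>0\<close>, which is where the loop goes.\<close>

definition LK1 :: "nat \<Rightarrow> nat graph" where
  "LK1 n = attach_loop 0 (star n)"

definition disjoint_union :: "'a graph \<Rightarrow> 'b graph \<Rightarrow> ('a + 'b) graph" where
  "disjoint_union G H =
     \<lparr>verts = verts G <+> verts H,
      edges = (\<lambda>e. Inl ` e) ` edges G \<union> (\<lambda>e. Inr ` e) ` edges H\<rparr>"

definition copies :: "nat \<Rightarrow> 'a graph \<Rightarrow> (nat \<times> 'a) graph" where
  "copies t G =
     \<lparr>verts = {1..t} \<times> verts G,
      edges = {Pair i ` e | i e. i \<in> {1..t} \<and> e \<in> edges G}\<rparr>"

text \<open>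
  A labeling is defined on the disjoint sum of the vertex set and the edge set: \<open>f (Inl x)\<close> is the
  label of the vertex \<open>x\<close>, \<open>f (Inr e)\<close> that of the edge \<open>e\<close>. In the last condition
  \<open>x = y\<close> is allowed, which gives \<open>2 f(x) + f(xx) = k\<close> for a loop.
\<close>

definition edge_magic_labeling :: "'a graph \<Rightarrow> ('a + 'a set \<Rightarrow> nat) \<Rightarrow> bool" where
  "edge_magic_labeling G f \<longleftrightarrow>
     bij_betw f (verts G <+> edges G) {1..card (verts G) + card (edges G)} \<and>
     (\<exists>k. \<forall>x y. {x, y} \<in> edges G \<longrightarrow> f (Inl x) + f (Inr {x, y}) + f (Inl y) = k)"

definition edge_magic :: "'a graph \<Rightarrow> bool" where
  "edge_magic G \<longleftrightarrow> (\<exists>f. edge_magic_labeling G f)"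

definition super_edge_magic :: "'a graph \<Rightarrow> bool" where
  "super_edge_magic G \<longleftrightarrow>
     (\<exists>f. edge_magic_labeling G f \<and> f ` Inl ` verts G = {1..card (verts G)})"

lemma wf_graph_LK1: "wf_graph (LK1 n)"
proof -
  have "\<exists>x\<in>{0..n}. \<exists>y\<in>{0..n}. {0::nat} = {x, y}"
    by (intro bexI[of _ 0]) auto
  then show ?thesis
    by (fastforce simp: wf_graph_def LK1_def attach_loop_def star_def)
qed

lemma wf_graph_disjoint_union:
  assumes "wf_graph G" "wf_graph H"
  shows "wf_graph (disjoint_union G H)"
proof -
  have "\<exists>x \<in> verts G <+> verts H. \<exists>y \<in> verts G <+> verts H. Inl ` e = {x, y}"
    if "e \<in> edges G" for e
  proof -
    from assms(1) that obtain x y where "x \<in> verts G" "y \<in> verts G" "e = {x, y}"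
      unfolding wf_graph_def by blast
    then show ?thesis by (intro bexI[of _ "Inl x"] bexI[of _ "Inl y"]) auto
  qed
  moreover have "\<exists>x \<in> verts G <+> verts H. \<exists>y \<in> verts G <+> verts H. Inr ` e = {x, y}"
    if "e \<in> edges H" for e
  proof -
    from assms(2) that obtain x y where "x \<in> verts H" "y \<in> verts H" "e = {x, y}"
      unfolding wf_graph_def by blast
    then show ?thesis by (intro bexI[of _ "Inr x"] bexI[of _ "Inr y"]) auto
  qed
  ultimately show ?thesis
    using assms by (auto simp: wf_graph_def disjoint_union_def)
qed

lemma wf_graph_copies:
  assumes "wf_graph G"
  shows "wf_graph (copies t G)"
proof -
  have "\<exists>x \<in> {1..t} \<times> verts G. \<exists>y \<in> {1..t} \<times> verts G. Pair i ` e = {x, y}"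
    if "i \<in> {1..t}" "e \<in> edges G" for i e
  proof -
    from assms that obtain x y where "x \<in> verts G" "y \<in> verts G" "e = {x, y}"
      unfolding wf_graph_def by blast
    with that show ?thesis by (intro bexI[of _ "(i, x)"] bexI[of _ "(i, y)"]) auto
  qed
  then show ?thesis
    using assms unfolding wf_graph_def copies_def by auto
qed

end

theory Submission
  imports Defs
begin

text \<open>
  It is enough to number the vertices by \<open>1, \<dots>, p\<close> so that the sums of the end labels, taken over
  all edges, are distinct and consecutive: the numbers \<open>p + 1, \<dots>, p + q\<close> can then be given
  to the edges in the order of decreasing sums (lemma \<open>super_edge_magic_if_consecutive_sums\<close>).

  Such a numbering is found as follows. If the centre of \<open>LK1 n\<close> has label \<open>c\<close>, then the edges of
  \<open>LK1 n\<close> (its loop included) have the sums \<open>c + v\<close>, where \<open>v\<close> runs through all labels used on that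
  component. These sums are consecutive except for the gaps \<open>c + v\<close> where \<open>v\<close> is one of the four
  labels used on the two copies of \<open>LK1 1\<close>, so the four edges of these copies should fill precisely
  these gaps. Let the copies have centres \<open>c + a\<close>, \<open>c + x\<close> and leaves \<open>c + b\<close>, \<open>c + y\<close>; then the
  requirement is \<open>{2a, a + b, 2x, x + y} = {a, b, x, y}\<close>. Comparing the sums of both sides gives
  \<open>x = -a\<close>, and then \<open>b = -2a\<close>, \<open>y = 2a\<close> is a solution. With \<open>a = 1\<close> this uses the labels from
  \<open>c - 2\<close> to \<open>c + 2\<close>, so \<open>c = 3\<close> leaves exactly the labels \<open>6, \<dots>, n + 5\<close> for the leaves of
  \<open>LK1 n\<close>.
\<close>

text \<open>
  On an edge \<open>{x, y}\<close> this is \<open>g x + g y\<close>, also for a loop; minimum and maximum make it a function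
  of the edge as a set.
\<close>

definition edge_sum :: "('a \<Rightarrow> nat) \<Rightarrow> 'a set \<Rightarrow> nat" where
  "edge_sum g e = Min (g ` e) + Max (g ` e)"

lemma edge_sum_pair [simp]: "edge_sum g {x, y} = g x + g y"
  by (simp add: edge_sum_def min_def max_def)

lemma edge_sum_loop [simp]: "edge_sum g {x} = 2 * g x"
  by (simp add: edge_sum_def)

text \<open>
  The edge \<open>e\<close> receives the label \<open>k - edge_sum g e\<close> with \<open>k = p + q + m\<close>. This makes all edges
  have the magic constant \<open>k\<close>, and as the sums run through \<open>m, \<dots>, m + q - 1\<close>, the edge labels run
  through \<open>p + q, \<dots>, p + 1\<close>, just above the vertex labels.
\<close>

lemma super_edge_magic_if_consecutive_sums:
  assumes g: "bij_betw g (verts G) {1..p}"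
    and s: "bij_betw (edge_sum g) (edges G) {m..<m + q}"
  shows "super_edge_magic G"
proof -
  define f where "f = case_sum g (\<lambda>e. p + q + m - edge_sum g e)"
  have card: "card (verts G) = p" "card (edges G) = q"
    using bij_betw_same_card[OF g] bij_betw_same_card[OF s] by simp_all
  have "bij_betw (\<lambda>t. p + q + m - t) {m..<m + q} {p + 1..p + q}"
    by (rule bij_betw_byWitness[where f' = "\<lambda>t. p + q + m - t"]) auto
  then have edge_labels: "bij_betw (\<lambda>e. f (Inr e)) (edges G) {p + 1..p + q}"
    using bij_betw_trans[OF s] by (simp add: f_def comp_def)
  have "bij_betw f (Inl ` verts G \<union> Inr ` edges G) ({1..p} \<union> {p + 1..p + q})"
  proof (rule bij_betw_combine)
    show "bij_betw f (Inl ` verts G) {1..p}"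
      using g by (simp add: f_def bij_betw_def inj_on_def image_image)
    show "bij_betw f (Inr ` edges G) {p + 1..p + q}"
      using edge_labels by (simp add: bij_betw_def inj_on_def image_image)
  qed auto
  moreover have "{1..p} \<union> {p + 1..p + q} = {1..p + q}"
    by auto
  ultimately have bij: "bij_betw f (verts G <+> edges G) {1..p + q}"
    by (simp add: Plus_def)
  have "f (Inl x) + f (Inr {x, y}) + f (Inl y) = p + q + m" if "{x, y} \<in> edges G" for x y
    using bij_betwE[OF s, rule_format, OF that] by (simp add: f_def)
  with bij have "edge_magic_labeling G f"
    unfolding edge_magic_labeling_def card by blast
  moreover have "f ` Inl ` verts G = {1..card (verts G)}"
    using bij_betw_imp_surj_on[OF g] by (simp add: f_def image_image card)
  ultimately show ?thesis
    unfolding super_edge_magic_def by blast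
qed

lemma verts_LK1: "verts (LK1 n) = {0..n}"
  by (simp add: LK1_def attach_loop_def star_def)

lemma edges_LK1: "edges (LK1 n) = insert {0} ((\<lambda>i. {0, i}) ` {1..n})"
  by (auto simp: LK1_def attach_loop_def star_def)

lemma verts_copies_2_LK1_1: "verts (copies 2 (LK1 1)) = {(1, 0), (1, 1), (2, 0), (2, 1)}"
  by (auto simp: copies_def verts_LK1)

lemma edges_copies_2_LK1_1:
  "edges (copies 2 (LK1 1)) = {{(1, 0)}, {(1, 0), (1, 1)}, {(2, 0)}, {(2, 0), (2, 1)}}"
proof -
  have "edges (copies 2 (LK1 1)) = (\<Union>i\<in>{1, 2}. (`) (Pair i) ` edges (LK1 1))"
    by (auto simp: copies_def numeral_2_eq_2 le_Suc_eq)
  also have "\<dots> = {{(1, 0)}, {(1, 0), (1, 1)}, {(2, 0)}, {(2, 0), (2, 1)}}"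
    by (auto simp: edges_LK1)
  finally show ?thesis .
qed

text \<open>The numbering found above with \<open>c = 3\<close> and \<open>a = 1\<close>.\<close>

definition vertex_number :: "(nat \<times> nat) + nat \<Rightarrow> nat" where
  "vertex_number v = (case v of
     Inl (i, j) \<Rightarrow> if i = 1 then (if j = 0 then 4 else 1) else (if j = 0 then 2 else 5)
   | Inr j \<Rightarrow> if j = 0 then 3 else j + 5)"

lemma bij_betw_vertex_number:
  "bij_betw vertex_number (verts (disjoint_union (copies 2 (LK1 1)) (LK1 n))) {1..n + 5}"
proof -
  let ?V = "{Inl (1, 0), Inl (1, 1), Inl (2, 0), Inl (2, 1), Inr 0} \<union> Inr ` {1..n}"
  have "{0..n} = insert 0 {1..n}"
    by auto
  then have V: "verts (disjoint_union (copies 2 (LK1 1)) (LK1 n)) = ?V"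
    unfolding disjoint_union_def Plus_def verts_copies_2_LK1_1 verts_LK1 by auto
  have "inj_on vertex_number ?V"
    by (auto simp: inj_on_def vertex_number_def)
  moreover have "vertex_number ` ?V = {1..n + 5}"
  proof -
    have "vertex_number ` Inr ` {1..n} = (\<lambda>j. j + 5) ` {1..n}"
      unfolding image_image by (rule image_cong) (auto simp: vertex_number_def)
    also have "\<dots> = {6..n + 5}"
      unfolding image_add_atLeastAtMost' by simp
    finally show ?thesis
      unfolding image_Un by (auto simp: vertex_number_def)
  qed
  ultimately show ?thesis
    unfolding V bij_betw_def by blast
qed

text \<open>
  The two copies of \<open>LK1 1\<close> contribute the sums \<open>8, 5\<close> and \<open>4, 7\<close>, the loop of \<open>LK1 n\<close> the sum
  \<open>6\<close>, and its other edges the sums \<open>9, \<dots>, n + 8\<close>.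
\<close>

lemma bij_betw_edge_sum_vertex_number:
  "bij_betw (edge_sum vertex_number) (edges (disjoint_union (copies 2 (LK1 1)) (LK1 n)))
     {4..<4 + (n + 5)}"
proof -
  let ?E = "{{Inl (1, 0)}, {Inl (1, 0), Inl (1, 1)}, {Inl (2, 0)}, {Inl (2, 0), Inl (2, 1)},
    {Inr 0}} \<union> (\<lambda>i. {Inr 0, Inr i}) ` {1..n}"
  have E: "edges (disjoint_union (copies 2 (LK1 1)) (LK1 n)) = ?E"
    unfolding disjoint_union_def edges_copies_2_LK1_1 edges_LK1
    by (simp add: image_image) blast
  have "inj_on (edge_sum vertex_number) ?E"
    unfolding inj_on_def by (auto simp: vertex_number_def)
  moreover have "edge_sum vertex_number ` ?E = {4..<4 + (n + 5)}"
  proof -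
    have "edge_sum vertex_number ` (\<lambda>i. {Inr 0, Inr i}) ` {1..n} = (\<lambda>i. i + 8) ` {1..n}"
      unfolding image_image by (rule image_cong) (auto simp: vertex_number_def)
    also have "\<dots> = {9..n + 8}"
      unfolding image_add_atLeastAtMost' by simp
    finally show ?thesis
      unfolding image_Un by (auto simp: vertex_number_def)
  qed
  ultimately show ?thesis
    unfolding E bij_betw_def by blast
qed

theorem theorem2p1:
  fixes n :: nat
  assumes "n \<ge> 1"
  shows "super_edge_magic (disjoint_union (copies 2 (LK1 1)) (LK1 n))"
  using bij_betw_vertex_number bij_betw_edge_sum_vertex_number
  by (rule super_edge_magic_if_consecutive_sums)

end
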